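(* Let $0\le a<b$ be real numbers and let $f:[a,b]\to\mathbb{R}$ be a continuous function with $f(x)\ge0$ for all $x\in[a,b]$. Let $V:[a,b]\times[a,b]\to\mathbb{R}$ be a function satisfying: (a) $V(x,y)+V(y,z)=V(x,z)$ for all $x,y,z\in[a,b]$; (b) $V(x,x+h)=\pm U(x,x+h)+o(h)$ as $h\to0_\pm$ for all $x\in[a,b]$, where $U(x,x+h)$ is the volume of the cylindrical shell obtained by revolving the rectangle with vertices $(x,0)$, $(x+h,0)$, $(x+h,f(x))$ and $(x,f(x))$ about the $y$-axis. Then $$V(a,b)=\int_a^b 2\pi x f(x)\,dx.$$ Consequently, the number $V(a,b)$ (the volume of revolution about the $y$-axis of the curve $y=f(x)$) is uniquely determined by properties (a) and (b).
   Context: In (b), the sign $+$ is taken as $h\to0_+$ and the sign $-$ as $h\to0_-$; $h\neq0$ ranges over values with $x+h\in[a,b]$ (so at $x=a$ and $x=b$ only one of the two one-sided conditions applies), and $o(h)$ denotes a quantity whose quotient by $h$ tends to $0$. The volume of the cylindrical shell is the elementary (nonnegative) one, i.e. $U(x,x+h)=|\pi(x+h)^2-\pi x^2|\,f(x)$. The integral is defined axiomatically: for a continuous $\rho:[a,b]\to\mathbb{R}$, $\int_a^b\rho(x)\,dx:=I(a,b)$, where $I:[a,b]\times[a,b]\to\mathbb{R}$ is the unique function with $I(x,y)+I(y,z)=I(x,z)$ for all $x,y,z\in[a,b]$ and $I(x,x+h)=\rho(x)h+o(h)$ as $h\to0$ for all $x\in[a,b]$; this coincides with the usual Riemann integral of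 $\rho$. *)

theory Defs
  imports "HOL-Analysis.Analysis"
begin

definition interval_additive :: "real \<Rightarrow> real \<Rightarrow> (real \<Rightarrow> real \<Rightarrow> real) \<Rightarrow> bool" where
  "interval_additive a b I \<longleftrightarrow>
     (\<forall>x\<in>{a..b}. \<forall>y\<in>{a..b}. \<forall>z\<in>{a..b}. I x y + I y z = I x z)"

text \<open>Functions on \<open>[a,b] \<times> [a,b]\<close> are total functions whose values outside the square are
  irrelevant. An error term is \<open>o(h)\<close> if its quotient by \<open>h\<close> tends to 0, where \<open>h \<noteq> 0\<close>
  ranges over the values with \<open>x + h \<in> [a,b]\<close>.\<close>

definition integral_function ::
    "real \<Rightarrow> real \<Rightarrow> (real \<Rightarrow> real) \<Rightarrow> (real \<Rightarrow> real \<Rightarrow> real) \<Rightarrow> bool" where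
  "integral_function a b \<rho> I \<longleftrightarrow>
     interval_additive a b I \<and>
     (\<forall>x\<in>{a..b}.
        ((\<lambda>h. (I x (x + h) - \<rho> x * h) / h) \<longlongrightarrow> 0) (at 0 within {h. x + h \<in> {a..b}}))"

text \<open>An integral function is unique only on the square \<open>[a,b] \<times> [a,b]\<close>, so the description
  ranges over its value at \<open>(a,b)\<close>. For continuous \<open>\<rho>\<close> this value exists, is unique and
  is the usual integral: see \<open>axiomatic_integral_eq_integral\<close>.\<close>

definition axiomatic_integral :: "real \<Rightarrow> real \<Rightarrow> (real \<Rightarrow> real) \<Rightarrow> real" where
  "axiomatic_integral a b \<rho> = (THE v. \<exists>I. integral_function a b \<rho> I \<and> v = I a b)"

text \<open>The shell between the radii \<open>x\<close> and \<open>y\<close> (in either order) with height \<open>f x\<close>.\<close>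

definition shell_volume :: "(real \<Rightarrow> real) \<Rightarrow> real \<Rightarrow> real \<Rightarrow> real" where
  "shell_volume f x y = \<bar>pi * y\<^sup>2 - pi * x\<^sup>2\<bar> * f x"

text \<open>At \<open>x = b\<close> (resp. \<open>x = a\<close>) the filter for \<open>h > 0\<close> (resp. \<open>h < 0\<close>) is trivial and
  the corresponding one-sided condition is vacuous.\<close>

definition revolution_volume_function ::
    "real \<Rightarrow> real \<Rightarrow> (real \<Rightarrow> real) \<Rightarrow> (real \<Rightarrow> real \<Rightarrow> real) \<Rightarrow> bool" where
  "revolution_volume_function a b f V \<longleftrightarrow>
     interval_additive a b V \<and>
     (\<forall>x\<in>{a..b}.
        ((\<lambda>h. (V x (x + h) - shell_volume f x (x + h)) / h) \<longlongrightarrow> 0)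
          (at 0 within {h. 0 < h \<and> x + h \<in> {a..b}}) \<and>
        ((\<lambda>h. (V x (x + h) - (- shell_volume f x (x + h))) / h) \<longlongrightarrow> 0)
          (at 0 within {h. h < 0 \<and> x + h \<in> {a..b}}))"

lemma quotient_o_iff_has_field_derivative:
  fixes F \<rho> :: "real \<Rightarrow> real"
  shows "((\<lambda>h. (F (x + h) - F x - \<rho> x * h) / h) \<longlongrightarrow> 0) (at 0 within {h. x + h \<in> S}) \<longleftrightarrow>
         (F has_field_derivative \<rho> x) (at x within S)"
proof -
  have img: "(\<lambda>h. h - x) ` S = {h. x + h \<in> S}"
    by (auto simp: image_iff) (metis add_diff_cancel_left')
  have "((\<lambda>h. (F (x + h) - F x - \<rho> x * h) / h) \<longlongrightarrow> 0) (at 0 within {h. x + h \<in> S}) \<longleftrightarrow>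
        ((\<lambda>h. (F (x + h) - F x) / h - \<rho> x) \<longlongrightarrow> 0) (at 0 within {h. x + h \<in> S})"
    by (intro filterlim_cong refl) (auto simp: eventually_at_filter diff_divide_distrib)
  also have "\<dots> \<longleftrightarrow> ((\<lambda>h. (F (x + h) - F x) / h) \<longlongrightarrow> \<rho> x) (at 0 within {h. x + h \<in> S})"
    by (rule LIM_zero_iff)
  also have "\<dots> \<longleftrightarrow> ((\<lambda>y. (F y - F x) / (y - x)) \<longlongrightarrow> \<rho> x) (at x within S)"
  proof -
    have "at x within S = filtermap (\<lambda>h. h + x) (at 0 within {h. x + h \<in> S})"
      unfolding filter_eq_iff eventually_filtermap eventually_at dist_real_def
      apply (intro allI iffI; elim exE conjE)
      subgoal for P d by (rule exI[of _ d]) (auto simp: add.commute)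
      subgoal for P d
        apply (rule exI[of _ d], safe)
        subgoal for y by (drule bspec[of _ _ "y - x"]) auto
        done
      done
    then show ?thesis
      by (simp add: filterlim_filtermap add.commute)
  qed
  finally show ?thesis
    by (simp add: has_field_derivative_iff)
qed

lemma integral_function_eq_integral:
  assumes "integral_function a b \<rho> I" "a \<le> b"
  shows "I a b = integral {a..b} \<rho>"
proof -
  have add: "I x y + I y z = I x z" if "x \<in> {a..b}" "y \<in> {a..b}" "z \<in> {a..b}" for x y z
    using assms(1) that unfolding integral_function_def interval_additive_def by blast
  have "(I a has_field_derivative \<rho> x) (at x within {a..b})" if x: "x \<in> {a..b}" for x
  proof -
    have "((\<lambda>h. (I x (x + h) - \<rho> x * h) / h) \<longlongrightarrow> 0) (at 0 within {h. x + h \<in> {a..b}})"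
      using assms(1) x unfolding integral_function_def by blast
    moreover have "I x (x + h) = I a (x + h) - I a x" if "x + h \<in> {a..b}" for h
      using add[of a x "x + h"] x that assms(2) by auto
    ultimately have "((\<lambda>h. (I a (x + h) - I a x - \<rho> x * h) / h) \<longlongrightarrow> 0)
        (at 0 within {h. x + h \<in> {a..b}})"
      by (elim filterlim_cong[THEN iffD1, rotated -1]) (auto simp: eventually_at_filter)
    then show ?thesis
      by (simp only: quotient_o_iff_has_field_derivative)
  qed
  then have "(\<rho> has_integral (I a b - I a a)) {a..b}"
    using assms(2)
    by (intro fundamental_theorem_of_calculus) (auto simp: has_real_derivative_iff_has_vector_derivative)
  moreover have "I a a = 0"
    using add[of a a a] assms(2) by auto
  ultimately show ?thesis
    by (simp add: integral_unique)
qed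

lemma integral_function_exists:
  assumes "continuous_on {a..b} \<rho>"
  shows "integral_function a b \<rho> (\<lambda>x y. integral {a..y} \<rho> - integral {a..x} \<rho>)"
  unfolding integral_function_def interval_additive_def
  by (auto simp: quotient_o_iff_has_field_derivative[where F = "\<lambda>y. integral {a..y} \<rho>" and S = "{a..b}", simplified]
      intro!: integral_has_real_derivative[OF assms])

theorem axiomatic_integral_eq_integral:
  assumes "continuous_on {a..b} \<rho>" "a \<le> b"
  shows "axiomatic_integral a b \<rho> = integral {a..b} \<rho>"
  unfolding axiomatic_integral_def
  using integral_function_exists[OF assms(1)] integral_function_eq_integral[OF _ assms(2)]
  by (intro the_equality) metis+

end

theory Submission
  imports Defs
begin

text \<open>For \<open>x \<ge> 0\<close> the signed shell volume is \<open>\<plusminus>U(x, x + h) = 2 \<pi> x f(x) h + \<pi> f(x) h\<^sup>2\<close>,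
  so condition (b) says exactly that \<open>V\<close> has density \<open>2 \<pi> x f(x)\<close> in the sense of the
  axiomatic integral.\<close>

lemma signed_shell_volume:
  assumes "0 \<le> x" "0 \<le> x + h"
  shows "sgn h * shell_volume f x (x + h) = 2 * pi * x * f x * h + pi * f x * h\<^sup>2"
proof -
  \<comment> \<open>Squaring is monotone on nonnegative reals, so with both radii nonnegative the
    difference of squares has the sign of \<open>h\<close>; at \<open>h = 0\<close> both sides
    vanish.\<close>
  have "sgn h * \<bar>(x + h)\<^sup>2 - x\<^sup>2\<bar> = (x + h)\<^sup>2 - x\<^sup>2"
  proof (cases "0 \<le> h")
    case True
    then have "x\<^sup>2 \<le> (x + h)\<^sup>2"
      using assms by (intro power_mono) auto
    then show ?thesis
      using True by (auto simp: sgn_if)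
  next
    case False
    then have "(x + h)\<^sup>2 \<le> x\<^sup>2"
      using assms by (intro power_mono) auto
    then show ?thesis
      using False by (auto simp: sgn_if)
  qed
  moreover have "shell_volume f x (x + h) = pi * \<bar>(x + h)\<^sup>2 - x\<^sup>2\<bar> * f x"
    by (simp add: shell_volume_def abs_mult flip: right_diff_distrib)
  ultimately have "sgn h * shell_volume f x (x + h) = pi * ((x + h)\<^sup>2 - x\<^sup>2) * f x"
    by (metis mult.assoc mult.left_commute)
  then show ?thesis
    by (simp add: power2_eq_square algebra_simps)
qed

text \<open>The two one-sided conditions glue to a single two-sided limit, and the quadratic part of
  the signed shell volume is \<open>o(h)\<close>, so only the linear part survives as
  density.\<close>

lemma revolution_volume_function_imp_integral_function:
  assumes "0 \<le> a" and V: "revolution_volume_function a b f V"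
  shows "integral_function a b (\<lambda>x. 2 * pi * x * f x) V"
  unfolding integral_function_def
proof (intro conjI ballI)
  show "interval_additive a b V"
    using V by (simp add: revolution_volume_function_def)
next
  fix x assume x: "x \<in> {a..b}"
  let ?S = "{h. x + h \<in> {a..b}}"
  let ?P = "{h. 0 < h \<and> x + h \<in> {a..b}}" and ?N = "{h. h < 0 \<and> x + h \<in> {a..b}}"
  \<comment> \<open>The factor \<open>sgn h\<close> merges both signs of (b) into one quotient,
    which agrees with the given ones on \<open>?P\<close> and on \<open>?N\<close>.\<close>
  let ?q = "\<lambda>h. (V x (x + h) - sgn h * shell_volume f x (x + h)) / h"
  have "(?q \<longlongrightarrow> 0) (at 0 within ?P)"
  proof (rule Lim_transform_eventually)
    show "((\<lambda>h. (V x (x + h) - shell_volume f x (x + h)) / h) \<longlongrightarrow> 0) (at 0 within ?P)"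
      using V x by (simp add: revolution_volume_function_def)
  qed (simp add: eventually_at_filter)
  moreover have "(?q \<longlongrightarrow> 0) (at 0 within ?N)"
  proof (rule Lim_transform_eventually)
    show "((\<lambda>h. (V x (x + h) - (- shell_volume f x (x + h))) / h) \<longlongrightarrow> 0) (at 0 within ?N)"
      using V x by (simp add: revolution_volume_function_def)
  qed (simp add: eventually_at_filter)
  ultimately have "(?q \<longlongrightarrow> 0) (at 0 within ?P \<union> ?N)"
    by (rule Lim_Un)
  \<comment> \<open>The union omits only \<open>h = 0\<close> from \<open>?S\<close>, a point the
    punctured filter ignores.\<close>
  moreover have "at 0 within ?P \<union> ?N = at 0 within ?S"
    unfolding at_within_def by (rule arg_cong[where f = "\<lambda>A. inf (nhds 0) (principal A)"]) auto
  ultimately have "(?q \<longlongrightarrow> 0) (at 0 within ?S)"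
    by simp
  \<comment> \<open>This is the quadratic part \<open>pi * f x * h\<^sup>2\<close> divided by
    \<open>h\<close>; adding it to \<open>?q\<close> leaves exactly the linear term
    subtracted.\<close>
  moreover have "((\<lambda>h. pi * f x * h) \<longlongrightarrow> 0) (at 0 within ?S)"
    by (auto intro!: tendsto_eq_intros)
  ultimately have "((\<lambda>h. ?q h + pi * f x * h) \<longlongrightarrow> 0) (at 0 within ?S)"
    by (rule tendsto_add_zero)
  then show "((\<lambda>h. (V x (x + h) - 2 * pi * x * f x * h) / h) \<longlongrightarrow> 0) (at 0 within ?S)"
  proof (rule Lim_transform_eventually)
    have "?q h + pi * f x * h = (V x (x + h) - 2 * pi * x * f x * h) / h"
      if "h \<noteq> 0" "x + h \<in> {a..b}" for h
    proof -
      have "sgn h * shell_volume f x (x + h) = 2 * pi * x * f x * h + pi * f x * h\<^sup>2"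
        using \<open>0 \<le> a\<close> x that by (intro signed_shell_volume) auto
      then show ?thesis
        using that by (simp add: field_simps power2_eq_square)
    qed
    then show "\<forall>\<^sub>F h in at 0 within ?S.
        ?q h + pi * f x * h = (V x (x + h) - 2 * pi * x * f x * h) / h"
      by (simp add: eventually_at_filter)
  qed
qed

theorem theorem4p3:
  fixes a b :: real and f :: "real \<Rightarrow> real" and V :: "real \<Rightarrow> real \<Rightarrow> real"
  assumes "0 \<le> a" and "a < b"
    and "continuous_on {a..b} f"
    and "\<forall>x\<in>{a..b}. f x \<ge> 0"
    and "revolution_volume_function a b f V"
  shows "V a b = axiomatic_integral a b (\<lambda>x. 2 * pi * x * f x) \<and>
         (\<forall>W. revolution_volume_function a b f W \<longrightarrow> W a b = V a b)"
proof -
  \<comment> \<open>Proved for arbitrary \<open>W\<close>, this serves both the formula for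
    \<open>V\<close> and uniqueness.\<close>
  have "W a b = integral {a..b} (\<lambda>x. 2 * pi * x * f x)"
    if "revolution_volume_function a b f W" for W
    using revolution_volume_function_imp_integral_function[OF assms(1) that] assms(2)
    by (intro integral_function_eq_integral) auto
  \<comment> \<open>Continuity of \<open>f\<close> enters here: the density is then continuous, so
    an integral function exists and the definite description denotes its value.\<close>
  moreover have "axiomatic_integral a b (\<lambda>x. 2 * pi * x * f x) =
      integral {a..b} (\<lambda>x. 2 * pi * x * f x)"
    using assms(2,3) by (intro axiomatic_integral_eq_integral continuous_intros) auto
  ultimately show ?thesis
    using assms(5) by metis
qed

end
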